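(* Let $A\in\mathrm{BDO}$ be invertible, put $\delta_k:=\operatorname{dist}(A,\mathrm{BO}_k)$ for $k=0,1,2,\dots$, and let $M:=\|A\|$, $m:=1/\|A^{-1}\|$ and $\kappa:=M/m=\|A\|\,\|A^{-1}\|$, as well as $$\alpha_k:=\frac{m}{m-2\delta_k},\qquad \kappa_k^{\pm}:=\frac{M\pm 2\delta_k}{m/\alpha_k}=\alpha_k\Big(\kappa\pm\frac{2\delta_k}{m}\Big).$$ (Note that $\delta_k\to0$ and $\alpha_k\to1$ as $k\to\infty$.) Then, for all $n\in\mathbb N_0$ and all sufficiently large $k\in\mathbb N_0$ (such that $\delta_k<m/2$), it holds that $$\operatorname{dist}\big(A^{-1},\mathrm{BO}_{3nk}\big)\ \le\ \frac{\alpha_k}{m^2}\left(2\delta_k+\alpha_k(M+2\delta_k)\left(\frac{(M+2\delta_k)^2-(m/\alpha_k)^2}{(M-2\delta_k)^2+(m/\alpha_k)^2}\right)^{n+1}\right)$$ $$=\ \frac{2\delta_k\alpha_k}{m^2}+\frac{(\kappa_k^+)^2}{M+2\delta_k}\left(\frac{(\kappa_k^+)^2-1}{(\kappa_k^-)^2+1}\right)^{n+1}.$$ In particular, $A^{-1}\in\mathrm{BDO}$.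
   Context: $\mathbb N_0:=\mathbb N\cup\{0\}$. Let $\mathcal I$ be either $\mathbb N$ or $\mathbb Z$, let $\ell^2=\ell^2(\mathcal I)$ be the Hilbert space of square-summable complex sequences indexed by $\mathcal I$, and let $\mathrm{BL}$ be the algebra of bounded linear operators on $\ell^2$ with the induced operator norm $\|\cdot\|$. Every $A\in\mathrm{BL}$ is identified with its matrix $(a_{ij})_{i,j\in\mathcal I}$ with respect to the standard basis. "Invertible" means bijective on $\ell^2$ (so $A^{-1}\in\mathrm{BL}$). For $k\in\mathbb N_0$, $\mathrm{BO}_k$ is the set of all $A\in\mathrm{BL}$ with $a_{ij}=0$ whenever $|i-j|>k$; $\mathrm{BO}:=\bigcup_{k\ge0}\mathrm{BO}_k$ (banded operators); $\mathrm{BDO}$ is the closure of $\mathrm{BO}$ in $\mathrm{BL}$ with respect to the operator norm (band-dominated operators). For $A\in\mathrm{BL}$ and $S\subset\mathrm{BL}$, $\operatorname{dist}(A,S):=\inf_{B\in S}\|A-B\|$.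
   Formalization: The distance bound is stated only for n ≥ 1 or k = 0, since for n = 0 and k ≥ 1 it fails (bilateral shift: the right-hand side is 0 but A^{-1} has distance 1 from BO_0); the equality of the two bounds is kept for all n. *)

theory Defs
  imports "HOL-Analysis.Analysis"
begin

section \<open>The Hilbert space of square-summable complex families\<close>

typedef 'i ell2 = "{x :: 'i \<Rightarrow> complex. (\<lambda>i. (norm (x i))\<^sup>2) summable_on UNIV}"
  morphisms ell2_nth Abs_ell2
  by (rule exI[of _ "\<lambda>_. 0"]) simp

setup_lifting type_definition_ell2

lemma ell2_nth_summable: "(\<lambda>i. (norm (ell2_nth x i))\<^sup>2) summable_on UNIV"
  using ell2_nth[of x] by simp

lemma ell2_add_aux:
  fixes x y :: "'i \<Rightarrow> complex"
  assumes "(\<lambda>i. (norm (x i))\<^sup>2) summable_on UNIV" "(\<lambda>i. (norm (y i))\<^sup>2) summable_on UNIV"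
  shows "(\<lambda>i. (norm (x i + y i))\<^sup>2) summable_on UNIV"
proof (rule summable_on_comparison_test)
  show "(\<lambda>i. 2 * (norm (x i))\<^sup>2 + 2 * (norm (y i))\<^sup>2) summable_on UNIV"
    by (intro summable_on_add summable_on_cmult_right assms)
  show "(norm (x i + y i))\<^sup>2 \<le> 2 * (norm (x i))\<^sup>2 + 2 * (norm (y i))\<^sup>2" for i
  proof -
    have "(norm (x i + y i))\<^sup>2 \<le> (norm (x i) + norm (y i))\<^sup>2"
      by (intro power_mono norm_triangle_ineq) auto
    also have "\<dots> \<le> 2 * (norm (x i))\<^sup>2 + 2 * (norm (y i))\<^sup>2"
      using sum_squares_bound[of "norm (x i)" "norm (y i)"] by (simp add: power2_sum)
    finally show ?thesis .
  qed
qed auto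

lemma ell2_scale_aux:
  fixes x :: "'i \<Rightarrow> complex"
  assumes "(\<lambda>i. (norm (x i))\<^sup>2) summable_on UNIV"
  shows "(\<lambda>i. (norm (c * x i))\<^sup>2) summable_on UNIV"
  using summable_on_cmult_right[OF assms, of "(norm c)\<^sup>2"]
  by (simp add: norm_mult power_mult_distrib)

lemma ell2_inner_aux:
  fixes x y :: "'i \<Rightarrow> complex"
  assumes "(\<lambda>i. (norm (x i))\<^sup>2) summable_on UNIV" "(\<lambda>i. (norm (y i))\<^sup>2) summable_on UNIV"
  shows "(\<lambda>i. inner (x i) (y i)) summable_on UNIV"
proof -
  have s: "(\<lambda>i. (norm (x i))\<^sup>2 + (norm (y i))\<^sup>2) summable_on UNIV"
    by (intro summable_on_add assms)
  have "(\<lambda>i. norm (inner (x i) (y i))) summable_on UNIV"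
  proof (rule summable_on_comparison_test[OF s])
    fix i
    have "norm (inner (x i) (y i)) \<le> norm (x i) * norm (y i)"
      using Cauchy_Schwarz_ineq2[of "x i" "y i"] by simp
    moreover have "2 * (norm (x i) * norm (y i)) \<le> (norm (x i))\<^sup>2 + (norm (y i))\<^sup>2"
      using sum_squares_bound[of "norm (x i)" "norm (y i)"] by simp
    moreover have "0 \<le> norm (x i) * norm (y i)"
      by simp
    ultimately show "norm (inner (x i) (y i)) \<le> (norm (x i))\<^sup>2 + (norm (y i))\<^sup>2"
      by linarith
  qed auto
  thus ?thesis
    by (rule abs_summable_summable)
qed

lift_definition scaleC_ell2 :: "complex \<Rightarrow> 'i ell2 \<Rightarrow> 'i ell2" (infixr \<open>*\<^sub>C\<close> 75)
  is "\<lambda>c x i. c * x i"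
  by (rule ell2_scale_aux)

text \<open>The real inner product below is the real part of the usual complex inner product
  of \<open>\<ell>\<^sup>2\<close>; both induce the same norm.\<close>

instantiation ell2 :: (type) real_inner
begin

lift_definition zero_ell2 :: "'a ell2" is "\<lambda>_. 0"
  by simp

lift_definition plus_ell2 :: "'a ell2 \<Rightarrow> 'a ell2 \<Rightarrow> 'a ell2" is "\<lambda>x y i. x i + y i"
  by (rule ell2_add_aux)

lift_definition uminus_ell2 :: "'a ell2 \<Rightarrow> 'a ell2" is "\<lambda>x i. - x i"
  by simp

lift_definition minus_ell2 :: "'a ell2 \<Rightarrow> 'a ell2 \<Rightarrow> 'a ell2" is "\<lambda>x y i. x i - y i"
  subgoal for x y
    using ell2_add_aux[of x "\<lambda>i. - y i"] by simp
  done

lift_definition scaleR_ell2 :: "real \<Rightarrow> 'a ell2 \<Rightarrow> 'a ell2" is "\<lambda>r x i. r *\<^sub>R x i"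
  subgoal for r x
    using ell2_scale_aux[of x "of_real r"] by (simp add: scaleR_conv_of_real)
  done

lift_definition inner_ell2 :: "'a ell2 \<Rightarrow> 'a ell2 \<Rightarrow> real"
  is "\<lambda>x y. \<Sum>\<^sub>\<infinity>i. inner (x i) (y i)" .

lift_definition norm_ell2 :: "'a ell2 \<Rightarrow> real"
  is "\<lambda>x. sqrt (\<Sum>\<^sub>\<infinity>i. (norm (x i))\<^sup>2)" .

definition dist_ell2 :: "'a ell2 \<Rightarrow> 'a ell2 \<Rightarrow> real"
  where "dist_ell2 x y = norm (x - y)"

definition sgn_ell2 :: "'a ell2 \<Rightarrow> 'a ell2"
  where "sgn_ell2 x = inverse (norm x) *\<^sub>R x"

definition uniformity_ell2 :: "('a ell2 \<times> 'a ell2) filter"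
  where "uniformity_ell2 = (INF e\<in>{0<..}. principal {(x, y). dist x y < e})"

definition open_ell2 :: "'a ell2 set \<Rightarrow> bool"
  where "open_ell2 U = (\<forall>x\<in>U. eventually (\<lambda>(x', y). x' = x \<longrightarrow> y \<in> U) uniformity)"

instance
proof
  fix x y z :: "'a ell2" and a b :: real and U :: "'a ell2 set"
  show "x + y + z = x + (y + z)" "x + y = y + x" "0 + x = x" "- x + x = 0" "x - y = x + - y"
    by (transfer; simp add: fun_eq_iff)+
  show "a *\<^sub>R (x + y) = a *\<^sub>R x + a *\<^sub>R y" "(a + b) *\<^sub>R x = a *\<^sub>R x + b *\<^sub>R x"
    "a *\<^sub>R b *\<^sub>R x = (a * b) *\<^sub>R x" "1 *\<^sub>R x = x"
    by (transfer; simp add: fun_eq_iff algebra_simps)+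
  show "sgn x = inverse (norm x) *\<^sub>R x" "dist x y = norm (x - y)"
    "uniformity = (INF e\<in>{0<..}. principal {(x, y :: 'a ell2). dist x y < e})"
    "open U = (\<forall>x\<in>U. eventually (\<lambda>(x', y). x' = x \<longrightarrow> y \<in> U) uniformity)"
    by (simp_all only: sgn_ell2_def dist_ell2_def uniformity_ell2_def open_ell2_def)
  show "inner x y = inner y x"
    by transfer (simp add: inner_commute)
  show "inner (x + y) z = inner x z + inner y z"
    by transfer (simp add: inner_add_left infsum_add ell2_inner_aux)
  show "inner (a *\<^sub>R x) y = a * inner x y"
    by transfer (simp add: infsum_cmult_right')
  show "0 \<le> inner x x"
    by transfer (simp add: infsum_nonneg)
  show "inner x x = 0 \<longleftrightarrow> x = 0"
  proof (transfer, safe)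
    fix x :: "'a \<Rightarrow> complex"
    assume s: "(\<lambda>i. (norm (x i))\<^sup>2) summable_on UNIV"
      and z: "(\<Sum>\<^sub>\<infinity>i. inner (x i) (x i)) = 0"
    show "x = (\<lambda>_. 0)"
    proof
      fix i
      have "inner (x i) (x i) = 0"
        by (rule nonneg_infsum_le_0D[where A = UNIV]) (use s z ell2_inner_aux[OF s s] in auto)
      thus "x i = 0"
        by simp
    qed
  qed simp
  show "norm x = sqrt (inner x x)"
    by transfer (simp add: power2_norm_eq_inner)
qed

end

lift_definition basis_ell2 :: "'i \<Rightarrow> 'i ell2" is "\<lambda>j i. if i = j then 1 else 0"
  subgoal for j
  proof -
    have "(\<lambda>i. (norm (if i = j then 1 else 0 :: complex))\<^sup>2) summable_on {j}"
      by simp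
    thus "(\<lambda>i. (norm (if i = j then 1 else 0 :: complex))\<^sup>2) summable_on UNIV"
      by (rule summable_on_cong_neutral[THEN iffD1, rotated -1]) auto
  qed
  done

section \<open>Index sets\<close>

text \<open>A type of this class is a copy of \<open>\<nat> = {1, 2, \<dots>}\<close> or of \<open>\<int>\<close>. The
  embedding \<open>int_index\<close> makes differences \<open>i - j\<close> available in both cases
  (subtraction on type \<^typ>\<open>nat\<close> truncates).\<close>

class ell2_index =
  fixes int_index :: "'a \<Rightarrow> int"
  assumes inj_int_index: "inj int_index"
    and range_int_index: "range int_index = {1..} \<or> range int_index = UNIV"

instantiation nat :: ell2_index
begin

definition int_index_nat :: "nat \<Rightarrow> int"
  where "int_index_nat n = int n + 1"

instance
proof
  show "inj (int_index :: nat \<Rightarrow> int)"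
    by (simp add: inj_def int_index_nat_def)
  have "range (int_index :: nat \<Rightarrow> int) = {1..}"
  proof safe
    fix k :: int assume "1 \<le> k"
    hence "k = int_index (nat (k - 1))"
      by (simp add: int_index_nat_def)
    thus "k \<in> range (int_index :: nat \<Rightarrow> int)"
      by blast
  qed (simp add: int_index_nat_def)
  thus "range (int_index :: nat \<Rightarrow> int) = {1..} \<or> range (int_index :: nat \<Rightarrow> int) = UNIV" ..
qed

end

instantiation int :: ell2_index
begin

definition int_index_int :: "int \<Rightarrow> int"
  where "int_index_int k = k"

instance
  by standard (auto simp: inj_def int_index_int_def)

end

section \<open>Banded and band-dominated operators\<close>

text \<open>Elements of \<open>'i ell2 \<Rightarrow>\<^sub>L 'i ell2\<close> are bounded and real-linear; \<open>BL\<close> consists of the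
  complex-linear ones. The norm and topology of this type are those of the operator norm.\<close>

definition BL :: "('i ell2 \<Rightarrow>\<^sub>L 'i ell2) set"
  where "BL = {A. \<forall>c x. blinfun_apply A (c *\<^sub>C x) = c *\<^sub>C blinfun_apply A x}"

definition mat_entry :: "('i ell2 \<Rightarrow>\<^sub>L 'i ell2) \<Rightarrow> 'i \<Rightarrow> 'i \<Rightarrow> complex"
  where "mat_entry A i j = ell2_nth (blinfun_apply A (basis_ell2 j)) i"

definition BO_k :: "nat \<Rightarrow> ('i::ell2_index ell2 \<Rightarrow>\<^sub>L 'i ell2) set"
  where "BO_k k = {A \<in> BL. \<forall>i j. \<bar>int_index i - int_index j\<bar> > int k \<longrightarrow> mat_entry A i j = 0}"

definition BO :: "('i::ell2_index ell2 \<Rightarrow>\<^sub>L 'i ell2) set"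
  where "BO = (\<Union>k. BO_k k)"

definition BDO :: "('i::ell2_index ell2 \<Rightarrow>\<^sub>L 'i ell2) set"
  where "BDO = BL \<inter> closure BO"

definition op_invertible :: "('i ell2 \<Rightarrow>\<^sub>L 'i ell2) \<Rightarrow> bool"
  where "op_invertible A \<longleftrightarrow> bij (blinfun_apply A)"

text \<open>The set-theoretic inverse of an invertible \<open>A\<close> is bounded (bounded inverse theorem), so
  \<^const>\<open>Blinfun\<close> is applied within its domain; \<open>op_inverse A\<close> is meaningless otherwise.\<close>

definition op_inverse :: "('i ell2 \<Rightarrow>\<^sub>L 'i ell2) \<Rightarrow> ('i ell2 \<Rightarrow>\<^sub>L 'i ell2)"
  where "op_inverse A = Blinfun (inv (blinfun_apply A))"

text \<open>Caveat on bounds of the form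
  \<open>infdist (op_inverse A) (BO_k (3 * n * k)) \<le> \<dots>\<close>: they come from the approximants
  \<open>p (B\<^sup>* B) B\<^sup>*\<close> of \<open>B\<^sup>-\<^sup>1\<close>, where \<open>B \<in> BO_k k\<close> is close to \<open>A\<close> and the polynomial \<open>p\<close>
  has degree \<open>n\<close>. These lie in \<open>BO_k ((2 * n + 1) * k)\<close>, which is contained in
  \<open>BO_k (3 * n * k)\<close> only if \<open>n \<ge> 1\<close> or \<open>k = 0\<close>. For \<open>n = 0\<close> and \<open>k \<ge> 1\<close> the bound fails
  for the bilateral shift: the right-hand side is \<open>0\<close>, but the inverse has distance \<open>1\<close>
  from the diagonal operators.\<close>

end

theory Submission
  imports Defs
begin

text \<open>
  Let \<open>c = m - 2 \<delta>\<^sub>k = m / \<alpha>\<^sub>k\<close>. A banded \<open>B \<in> BO_k k\<close> with \<open>\<parallel>A - B\<parallel> \<le> 2 \<delta>\<^sub>k\<close> is still invertible, with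
  \<open>\<parallel>B\<^sup>-\<^sup>1\<parallel> \<le> 1 / c\<close>, and \<open>A\<^sup>-\<^sup>1 - B\<^sup>-\<^sup>1 = A\<^sup>-\<^sup>1 (B - A) B\<^sup>-\<^sup>1\<close> accounts for the first summand of the bound.
  The second one comes from the Richardson iteration for the normal equation: the spectrum of
  \<open>B\<^sup>* B\<close> lies in \<open>[c\<^sup>2, b\<^sup>2]\<close> with \<open>b = \<parallel>B\<parallel>\<close>, so \<open>R = 1 - \<tau> B\<^sup>* B\<close> with \<open>\<tau> = 2 / (b\<^sup>2 + c\<^sup>2)\<close> has norm at
  most \<open>(b\<^sup>2 - c\<^sup>2) / (b\<^sup>2 + c\<^sup>2)\<close>. The operator \<open>C = \<tau> (1 + R + \<dots> + R\<^sup>n) B\<^sup>*\<close> has bandwidth \<open>(2 n + 1) k\<close>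
  and satisfies \<open>B\<^sup>-\<^sup>1 - C = R\<^sup>n\<^sup>+\<^sup>1 B\<^sup>-\<^sup>1\<close>. Only real combinations occur, so the real inner product suffices.
\<close>

section \<open>The bounded inverse theorem\<close>

text \<open>Contrapositive of the Baire category theorem: closed sets with empty interior would have
  a union with empty interior, but here the union is the whole space.\<close>

lemma Baire_closed_Union:
  fixes F :: "nat \<Rightarrow> 'a::complete_space set"
  assumes "\<And>n. closed (F n)" "(\<Union>n. F n) = UNIV"
  obtains n where "interior (F n) \<noteq> {}"
proof -
  have "\<exists>n. interior (F n) \<noteq> {}"
  proof (rule ccontr)
    assume "\<nexists>n. interior (F n) \<noteq> {}"
    then have "Met_TC.mtopology interior_of \<Union>(range F) = {}"
      using assms by (intro Met_TC.metric_Baire_category_alt) (auto simp: complete_UNIV)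
    then show False
      using assms by simp
  qed
  then show thesis
    using that by blast
qed

text \<open>First half of the open mapping theorem. Baire makes only the closure of the image of
  some ball large, so \<open>y\<close> is reached up to an error; half of \<open>norm y\<close> is
  small enough to iterate.\<close>

lemma surj_approx_preimage:
  fixes f :: "'a::real_normed_vector \<Rightarrow> 'b::banach"
  assumes f: "bounded_linear f" and "surj f"
  obtains C where "\<And>y. \<exists>x. norm x \<le> C * norm y \<and> norm (y - f x) \<le> norm y / 2"
proof -
  interpret f: bounded_linear f by (rule f)
  define F where "F n = closure (f ` cball 0 (real n))" for n
  have "(\<Union>n. F n) = UNIV"
  proof -
    have "y \<in> (\<Union>n. F n)" for y
    proof -
      obtain x where "y = f x"
        using \<open>surj f\<close> by blast
      moreover obtain n where "norm x \<le> real n"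
        using real_arch_simple by blast
      ultimately have "y \<in> F n"
        unfolding F_def by (intro subsetD[OF closure_subset]) auto
      then show ?thesis
        by blast
    qed
    then show ?thesis
      by blast
  qed
  then obtain n where "interior (F n) \<noteq> {}"
    using Baire_closed_Union[of F] F_def closed_closure by metis
  then obtain y0 r where r: "r > 0" and ball: "ball y0 r \<subseteq> F n"
    by (metis all_not_in_conv mem_interior)
  have near: "\<exists>x. norm x \<le> real n \<and> norm (w - f x) < e" if "dist y0 w < r" "e > 0" for w e
  proof -
    have "w \<in> closure (f ` cball 0 (real n))"
      using ball that by (auto simp: F_def)
    then show ?thesis
      using \<open>e > 0\<close> by (fastforce simp: closure_approachable dist_norm norm_minus_commute)
  qed
  \<comment> \<open>The ball from Baire is centred at \<open>y0\<close>. Half the difference of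
    approximate preimages of \<open>y0 + z\<close> and \<open>y0 - z\<close> recentres it at 0 and
    keeps the bound \<open>real n\<close>.\<close>
  have sym: "\<exists>x. norm x \<le> real n \<and> norm (z - f x) < e" if z: "norm z < r" and e: "e > 0" for z e
  proof -
    obtain x1 where x1: "norm x1 \<le> real n" "norm (y0 + z - f x1) < e"
      using near[of "y0 + z" e] z e by (auto simp: dist_norm)
    obtain x2 where x2: "norm x2 \<le> real n" "norm (y0 - z - f x2) < e"
      using near[of "y0 - z" e] z e by (auto simp: dist_norm)
    define x where "x = (1/2) *\<^sub>R (x1 - x2)"
    have "z - f x = (1/2) *\<^sub>R ((y0 + z - f x1) - (y0 - z - f x2))"
      by (simp add: x_def f.scaleR f.diff algebra_simps) (simp flip: scaleR_2 scaleR_left_distrib)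
    moreover have "norm ((y0 + z - f x1) - (y0 - z - f x2)) < 2 * e"
      using norm_triangle_ineq4[of "y0 + z - f x1" "y0 - z - f x2"] x1 x2 by linarith
    ultimately have "norm (z - f x) < e"
      by simp
    moreover have "norm x \<le> real n"
      using norm_triangle_ineq4[of x1 x2] x1 x2 by (simp add: x_def)
    ultimately show ?thesis
      by blast
  qed
  have "\<exists>x. norm x \<le> (2 * real n / r) * norm y \<and> norm (y - f x) \<le> norm y / 2" for y
  proof (cases "y = 0")
    case True
    then show ?thesis
      by (intro exI[of _ 0]) (simp add: f.zero)
  next
    case False
    \<comment> \<open>\<open>(1/s) *\<^sub>R y\<close> has norm \<open>r/2\<close>, hence lies in
      the ball, and the tolerance \<open>r/4\<close> scales back to
      \<open>norm y / 2\<close>.\<close>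
    define s where "s = 2 * norm y / r"
    have s: "s > 0"
      using False r by (simp add: s_def)
    have "norm ((1/s) *\<^sub>R y) < r"
      using False r by (simp add: s_def)
    then obtain x where x: "norm x \<le> real n" "norm ((1/s) *\<^sub>R y - f x) < r/4"
      using sym[of "(1/s) *\<^sub>R y" "r/4"] r by (meson divide_pos_pos zero_less_numeral)
    have "y - f (s *\<^sub>R x) = s *\<^sub>R ((1/s) *\<^sub>R y - f x)"
      using s by (simp add: f.scaleR algebra_simps)
    then have "norm (y - f (s *\<^sub>R x)) \<le> s * (r/4)"
      using x s by simp
    also have "\<dots> = norm y / 2"
      using r by (simp add: s_def)
    finally have "norm (y - f (s *\<^sub>R x)) \<le> norm y / 2" .
    moreover have "norm (s *\<^sub>R x) \<le> (2 * real n / r) * norm y"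
      using mult_left_mono[OF x(1), of s] s r by (simp add: s_def field_simps)
    ultimately show ?thesis
      by blast
  qed
  then show thesis
    using that by blast
qed

text \<open>Successive approximation: the residuals \<open>Y k\<close> are at least halved in each
  step, so the corrections \<open>g (Y k)\<close> are dominated by a geometric series. Their sum
  exists by completeness of the domain, and \<open>f\<close> maps it to \<open>y\<close> by
  telescoping.\<close>

lemma surj_bounded_preimage:
  fixes f :: "'a::banach \<Rightarrow> 'b::banach"
  assumes f: "bounded_linear f" and "surj f"
  obtains C where "\<And>y. \<exists>x. f x = y \<and> norm x \<le> C * norm y"
proof -
  interpret f: bounded_linear f by (rule f)
  obtain C g where g: "\<And>y. norm (g y) \<le> C * norm y" "\<And>y. norm (y - f (g y)) \<le> norm y / 2"
    using surj_approx_preimage[OF assms] by metis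
  have "\<exists>x. f x = y \<and> norm x \<le> 2 * C * norm y" for y
  proof -
    define Y where "Y = rec_nat y (\<lambda>_ z. z - f (g z))"
    have Y0: "Y 0 = y" and YS: "Y (Suc k) = Y k - f (g (Y k))" for k
      by (simp_all add: Y_def)
    have normY: "norm (Y k) \<le> norm y * (1/2) ^ k" for k
    proof (induction k)
      case (Suc k)
      then show ?case
        using g(2)[of "Y k"] by (simp add: YS)
    qed (simp add: Y0)
    \<comment> \<open>If the target space is trivial, \<open>C\<close> may be negative; hence the
      case \<open>y = 0\<close> is split off below.\<close>
    have C: "C * norm z \<ge> 0" for z :: 'b
      using g(1)[of z] norm_ge_zero order_trans by blast
    have gY: "norm (g (Y k)) \<le> C * norm y * (1/2) ^ k" for k
    proof (cases "y = 0")
      case True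
      then show ?thesis
        using normY[of k] g(1)[of "Y k"] by simp
    next
      case False
      then have "C \<ge> 0"
        using C[of y] by (simp add: zero_le_mult_iff)
      then show ?thesis
        using g(1)[of "Y k"] mult_left_mono[OF normY[of k], of C] by (simp add: mult.assoc)
    qed
    have geo: "(\<lambda>k. C * norm y * (1/2) ^ k) sums (C * norm y * 2)"
      using sums_mult[OF geometric_sums[of "1/2::real"], of "C * norm y"] by simp
    have sg: "summable (\<lambda>k. norm (g (Y k)))"
      by (rule summable_comparison_test'[OF sums_summable[OF geo]]) (use gY in auto)
    define x where "x = (\<Sum>k. g (Y k))"
    have "norm x \<le> (\<Sum>k. norm (g (Y k)))"
      unfolding x_def by (rule summable_norm[OF sg])
    also have "\<dots> \<le> C * norm y * 2"
      using suminf_le[OF gY sg sums_summable[OF geo]] sums_unique[OF geo] by simp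
    finally have "norm x \<le> 2 * C * norm y"
      by simp
    moreover have "f x = y"
    proof -
      have "(\<lambda>k. g (Y k)) sums x"
        unfolding x_def using summable_norm_cancel[OF sg] by (rule summable_sums)
      then have "(\<lambda>k. f (g (Y k))) sums f x"
        by (rule f.sums)
      moreover have "Y \<longlonglongrightarrow> 0"
      proof (rule Lim_null_comparison[of _ "\<lambda>k. norm y * (1/2) ^ k"])
        show "(\<lambda>k. norm y * (1/2) ^ k) \<longlonglongrightarrow> 0"
          by (intro tendsto_mult_right_zero LIMSEQ_power_zero) simp
      qed (use normY in auto)
      then have "(\<lambda>k. Y k - Y (Suc k)) sums (Y 0 - 0)"
        by (rule telescope_sums')
      then have "(\<lambda>k. f (g (Y k))) sums y"
        by (simp add: YS Y0)
      ultimately show ?thesis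
        by (rule sums_unique2)
    qed
    ultimately show ?thesis
      by blast
  qed
  then show thesis
    using that by blast
qed

text \<open>By injectivity the preimage of controlled norm is the only one, so its constant bounds
  the inverse.\<close>

theorem bounded_linear_inv:
  fixes f :: "'a::banach \<Rightarrow> 'b::banach"
  assumes f: "bounded_linear f" and "bij f"
  shows "bounded_linear (inv f)"
proof -
  interpret f: bounded_linear f by (rule f)
  have inj: "inj f" and surj: "surj f"
    using \<open>bij f\<close> by (simp_all add: bij_def)
  obtain C where C: "\<And>y. \<exists>x. f x = y \<and> norm x \<le> C * norm y"
    using surj_bounded_preimage[OF f surj] by blast
  show ?thesis
  proof (rule bounded_linear_intro)
    fix x y and r :: real
    have "f (inv f x + inv f y) = x + y" "f (r *\<^sub>R inv f x) = r *\<^sub>R x"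
      by (simp_all add: f.add f.scaleR surj_f_inv_f[OF surj])
    then show "inv f (x + y) = inv f x + inv f y" "inv f (r *\<^sub>R x) = r *\<^sub>R inv f x"
      by (metis inj inv_f_f)+
    show "norm (inv f x) \<le> norm x * C"
      using C[of x] inj by (metis inv_f_f mult.commute)
  qed
qed

section \<open>Perturbation of inverses and Richardson iteration\<close>

text \<open>Solving \<open>B x = y\<close> means finding a fixed point of
  \<open>x \<mapsto> S (y + (A - B) x)\<close>, a contraction with constant
  \<open>norm S * norm (A - B)\<close>. The splitting \<open>x = S (B x) + S ((A - B) x)\<close>
  then bounds \<open>norm x\<close> by a multiple of \<open>norm (B x)\<close>, which gives
  injectivity and the norm of the inverse.\<close>

lemma invertible_perturbation:
  fixes A B S :: "'a::banach \<Rightarrow>\<^sub>L 'a"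
  assumes AS: "A o\<^sub>L S = id_blinfun" and SA: "S o\<^sub>L A = id_blinfun"
    and less: "norm S * norm (A - B) < 1"
  obtains T where "B o\<^sub>L T = id_blinfun" "T o\<^sub>L B = id_blinfun"
    "norm T \<le> norm S / (1 - norm S * norm (A - B))"
proof -
  have ASx: "A (S x) = x" and SAx: "S (A x) = x" for x
    using arg_cong[OF AS, of "\<lambda>C. blinfun_apply C x"] arg_cong[OF SA, of "\<lambda>C. blinfun_apply C x"]
    by simp_all
  define s where "s = norm S * norm (A - B)"
  have s: "s < 1"
    using less by (simp add: s_def)
  have contr: "norm (S ((A - B) x)) \<le> s * norm x" for x
    using order_trans[OF norm_blinfun mult_left_mono[OF norm_blinfun norm_ge_zero]]
    by (simp add: s_def mult.assoc)
  have "\<exists>x. B x = y" for y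
  proof -
    have "\<exists>!x. S (y + (A - B) x) = x"
    proof (rule banach_fix_type[where c = s])
      have "dist (S (y + (A - B) u)) (S (y + (A - B) v)) = norm (S ((A - B) (u - v)))" for u v
        by (simp add: dist_norm blinfun.diff_right blinfun.add_right)
      then show "\<forall>u v. dist (S (y + (A - B) u)) (S (y + (A - B) v)) \<le> s * dist u v"
        using contr by (simp add: dist_norm)
    qed (use s in \<open>auto simp: s_def\<close>)
    then obtain x where "S (y + (A - B) x) = x"
      by blast
    then have "y + (A - B) x = A x"
      using ASx by metis
    then show ?thesis
      by (auto simp: blinfun.diff_left)
  qed
  then obtain T where BT: "\<And>y. B (T y) = y"
    by metis
  have below: "norm x \<le> norm S / (1 - s) * norm (B x)" for x
  proof -
    have "x = S (B x) + S ((A - B) x)"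
      by (simp add: SAx blinfun.diff_left blinfun.diff_right)
    then have "norm x \<le> norm (S (B x)) + norm (S ((A - B) x))"
      by (metis norm_triangle_ineq)
    also have "\<dots> \<le> norm S * norm (B x) + s * norm x"
      by (intro add_mono norm_blinfun contr)
    finally show ?thesis
      using s by (simp add: field_simps)
  qed
  have inj: "x = y" if "B x = B y" for x y
    using below[of "x - y"] that by (simp add: blinfun.diff_right)
  have lin: "bounded_linear T"
  proof (rule bounded_linear_intro)
    show "T (x + y) = T x + T y" "T (r *\<^sub>R x) = r *\<^sub>R T x" for x y r
      by (rule inj; simp add: BT blinfun.add_right blinfun.scaleR_right)+
    show "norm (T x) \<le> norm x * (norm S / (1 - s))" for x
      using below[of "T x"] by (simp add: BT mult.commute)
  qed
  have TB: "T (B x) = x" for x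
    by (rule inj) (simp add: BT)
  have [simp]: "blinfun_apply (Blinfun T) = T"
    by (rule bounded_linear_Blinfun_apply[OF lin])
  show thesis
  proof
    show "B o\<^sub>L Blinfun T = id_blinfun" "Blinfun T o\<^sub>L B = id_blinfun"
      by (rule blinfun_eqI; simp add: BT TB)+
    show "norm (Blinfun T) \<le> norm S / (1 - norm S * norm (A - B))"
    proof (rule norm_blinfun_bound)
      show "0 \<le> norm S / (1 - norm S * norm (A - B))"
        using less by simp
      show "norm (Blinfun T x) \<le> norm S / (1 - norm S * norm (A - B)) * norm x" for x
        using below[of "T x"] by (simp add: BT s_def)
    qed
  qed
qed

text \<open>The hypothesis controls the quadratic form only, whereas the norm involves
  \<open>inner (R x) y\<close> for \<open>y\<close> other than \<open>x\<close>; symmetry bridges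
  the gap by polarization. This turns bounds on the form of \<open>B' B\<close> into a norm
  estimate.\<close>

lemma norm_symmetric_blinfun_le:
  fixes R :: "'a::real_inner \<Rightarrow>\<^sub>L 'a"
  assumes sym: "\<And>x y. inner (R x) y = inner x (R y)"
    and form: "\<And>x. \<bar>inner (R x) x\<bar> \<le> q * (norm x)\<^sup>2" and "q \<ge> 0"
  shows "norm R \<le> q"
proof (rule norm_blinfun_bound[OF \<open>q \<ge> 0\<close>])
  fix x
  show "norm (R x) \<le> q * norm x"
  proof (cases "R x = 0 \<or> x = 0")
    case True
    then show ?thesis
      using \<open>q \<ge> 0\<close> by auto
  next
    case False
    \<comment> \<open>\<open>y\<close> points along \<open>R x\<close>, so Cauchy-Schwarz is an
      equality, and it has the norm of \<open>x\<close>, so the two squares in the parallelogram law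
      combine.\<close>
    define y where "y = (norm x / norm (R x)) *\<^sub>R R x"
    have y: "norm y = norm x" "inner (R x) y = norm x * norm (R x)"
      using False by (simp_all add: y_def power2_eq_square flip: power2_norm_eq_inner)
    \<comment> \<open>polarization and the parallelogram law\<close>
    have "4 * inner (R x) y = inner (R (x + y)) (x + y) - inner (R (x - y)) (x - y)"
      using sym[of x y] by (simp add: blinfun.add_right blinfun.diff_right inner_simps inner_commute)
    also have "\<dots> \<le> q * (norm (x + y))\<^sup>2 + q * (norm (x - y))\<^sup>2"
      using form[of "x + y"] form[of "x - y"] by linarith
    also have "\<dots> = q * (2 * (norm x)\<^sup>2 + 2 * (norm y)\<^sup>2)"
      by (simp add: power2_norm_eq_inner inner_simps inner_commute algebra_simps)
    finally show ?thesis
      using False by (simp add: y power2_eq_square)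
  qed
qed

section \<open>Richardson iteration for the normal equation\<close>

definition Richardson_op :: "real \<Rightarrow> ('a::real_normed_vector \<Rightarrow>\<^sub>L 'a) \<Rightarrow> ('a \<Rightarrow>\<^sub>L 'a) \<Rightarrow> 'a \<Rightarrow>\<^sub>L 'a"
  where "Richardson_op \<tau> B B' = id_blinfun - \<tau> *\<^sub>R (B' o\<^sub>L B)"

text \<open>Horner form of \<open>\<tau> (1 + R + ... + R^n) B'\<close>, where
  \<open>R = Richardson_op \<tau> B B'\<close> propagates the error of one step for
  \<open>B' B x = B' y\<close>. In the application \<open>B'\<close> is the adjoint of
  \<open>B\<close>.\<close>

primrec Richardson :: "real \<Rightarrow> ('a::real_normed_vector \<Rightarrow>\<^sub>L 'a) \<Rightarrow> ('a \<Rightarrow>\<^sub>L 'a) \<Rightarrow> nat \<Rightarrow> 'a \<Rightarrow>\<^sub>L 'a"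
  where
    "Richardson \<tau> B B' 0 = \<tau> *\<^sub>R B'"
  | "Richardson \<tau> B B' (Suc n) = \<tau> *\<^sub>R B' + (Richardson_op \<tau> B B' o\<^sub>L Richardson \<tau> B B' n)"

text \<open>Since \<open>B T = 1\<close>, the inverse is a fixed point,
  \<open>T = \<tau> B' + R T\<close>, and each step multiplies the error by \<open>R\<close>. The
  error at index 0 is already \<open>R T\<close>, hence the exponent \<open>Suc n\<close>.\<close>

lemma norm_inverse_diff_Richardson_le:
  assumes BT: "B o\<^sub>L T = id_blinfun" and q: "norm (Richardson_op \<tau> B B') \<le> q"
  shows "norm (T - Richardson \<tau> B B' n) \<le> q ^ Suc n * norm T"
proof -
  define R where "R = Richardson_op \<tau> B B'"
  have [simp]: "B (T x) = x" for x
    using arg_cong[OF BT, of "\<lambda>C. blinfun_apply C x"] by simp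
  have "q \<ge> 0"
    using q norm_ge_zero order_trans by blast
  have step: "norm (R o\<^sub>L D) \<le> q * norm D" for D
    using norm_blinfun_compose[of R D] mult_right_mono[OF q norm_ge_zero[of D]]
    by (simp add: R_def)
  show ?thesis
  proof (induction n)
    case 0
    have "T - Richardson \<tau> B B' 0 = R o\<^sub>L T"
      by (auto intro!: blinfun_eqI simp: R_def Richardson_op_def blinfun.diff_left blinfun.scaleR_left)
    then show ?case
      using step[of T] by simp
  next
    case (Suc n)
    have "T - Richardson \<tau> B B' (Suc n) = R o\<^sub>L (T - Richardson \<tau> B B' n)"
      by (auto intro!: blinfun_eqI simp: R_def Richardson_op_def blinfun.diff_left blinfun.add_left
          blinfun.diff_right blinfun.scaleR_left algebra_simps)
    then show ?case
      using step[of "T - Richardson \<tau> B B' n"] mult_left_mono[OF Suc \<open>q \<ge> 0\<close>]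
      by (simp add: mult.assoc)
  qed
qed

text \<open>The form of \<open>R\<close> lies between \<open>1 - \<tau> b^2\<close> and
  \<open>1 - \<tau> c^2\<close> times the squared norm. The choice
  \<open>\<tau> = 2 / (b^2 + c^2)\<close> makes these two numbers opposite.\<close>

lemma norm_Richardson_op_le:
  fixes B B' :: "'a::real_inner \<Rightarrow>\<^sub>L 'a"
  assumes adj: "\<And>x y. inner (B' x) y = inner x (B y)"
    and c: "\<And>x. c * norm x \<le> norm (B x)" "c > 0" "c \<le> b" and b: "norm B \<le> b"
  shows "norm (Richardson_op (2 / (b\<^sup>2 + c\<^sup>2)) B B') \<le> (b\<^sup>2 - c\<^sup>2) / (b\<^sup>2 + c\<^sup>2)"
proof (rule norm_symmetric_blinfun_le)
  define R where "R = Richardson_op (2 / (b\<^sup>2 + c\<^sup>2)) B B'"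
  have pos: "b\<^sup>2 + c\<^sup>2 > 0"
    using \<open>c > 0\<close> by (simp add: add_nonneg_pos)
  show "(b\<^sup>2 - c\<^sup>2) / (b\<^sup>2 + c\<^sup>2) \<ge> 0"
    using c by (simp add: power_mono)
  have inner_R: "inner (R x) y = inner x y - 2 / (b\<^sup>2 + c\<^sup>2) * inner (B x) (B y)" for x y
    by (simp add: R_def Richardson_op_def blinfun.diff_left blinfun.scaleR_left inner_diff_left adj)
  show "inner (R x) y = inner x (R y)" for x y
    using inner_R[of x y] inner_R[of y x] by (simp add: inner_commute)
  show "\<bar>inner (R x) x\<bar> \<le> (b\<^sup>2 - c\<^sup>2) / (b\<^sup>2 + c\<^sup>2) * (norm x)\<^sup>2" for x
  proof -
    have "(c * norm x)\<^sup>2 \<le> (norm (B x))\<^sup>2"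
      using c by (intro power_mono) auto
    moreover have "norm (B x) \<le> b * norm x"
      using norm_blinfun[of B x] mult_right_mono[OF b norm_ge_zero[of x]] by linarith
    then have "(norm (B x))\<^sup>2 \<le> (b * norm x)\<^sup>2"
      by (intro power_mono) auto
    moreover have "(b\<^sup>2 + c\<^sup>2) * inner (R x) x = (b\<^sup>2 + c\<^sup>2) * (norm x)\<^sup>2 - 2 * (norm (B x))\<^sup>2"
      using \<open>c > 0\<close> pos by (simp add: inner_R right_diff_distrib power2_norm_eq_inner)
    ultimately have "\<bar>(b\<^sup>2 + c\<^sup>2) * inner (R x) x\<bar> \<le> (b\<^sup>2 - c\<^sup>2) * (norm x)\<^sup>2"
      by (simp add: power_mult_distrib algebra_simps abs_le_iff)
    then have "(b\<^sup>2 + c\<^sup>2) * \<bar>inner (R x) x\<bar> \<le> (b\<^sup>2 - c\<^sup>2) * (norm x)\<^sup>2"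
      using pos by (simp add: abs_mult)
    then show ?thesis
      using pos by (simp add: pos_le_divide_eq mult.commute)
  qed
qed

section \<open>Completeness and adjoints on \<open>\<ell>\<^sup>2\<close>\<close>

lemmas ell2_nth_simps [simp] =
  zero_ell2.rep_eq plus_ell2.rep_eq uminus_ell2.rep_eq minus_ell2.rep_eq scaleR_ell2.rep_eq
  scaleC_ell2.rep_eq basis_ell2.rep_eq

lemma ell2_eqI: "(\<And>i. ell2_nth x i = ell2_nth y i) \<Longrightarrow> x = y"
  by (simp add: ell2_nth_inject[symmetric] fun_eq_iff)

lemma norm_ell2_squared: "(norm x)\<^sup>2 = (\<Sum>\<^sub>\<infinity>i. (norm (ell2_nth x i))\<^sup>2)"
  by (simp add: norm_ell2.rep_eq infsum_nonneg)

lemma sum_norm_ell2_nth_le: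
  assumes "finite F"
  shows "(\<Sum>i\<in>F. (norm (ell2_nth x i))\<^sup>2) \<le> (norm x)\<^sup>2"
  unfolding norm_ell2_squared
  by (rule finite_sum_le_infsum) (use assms ell2_nth_summable in auto)

lemma norm_ell2_nth_le: "norm (ell2_nth x i) \<le> norm x"
  using sum_norm_ell2_nth_le[of "{i}" x] by (simp add: power2_le_iff_abs_le)

lemma bounded_linear_ell2_nth: "bounded_linear (\<lambda>x. ell2_nth x i)"
  by (rule bounded_linear_intro[where K = 1]) (use norm_ell2_nth_le in auto)

lemmas ell2_nth_sum = bounded_linear.linear[OF bounded_linear_ell2_nth, THEN linear_sum]
lemmas continuous_on_ell2_nth = bounded_linear.continuous_on[OF bounded_linear_ell2_nth]

text \<open>Finite partial sums decide both membership and norm. Limits of Cauchy sequences and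
  adjoint vectors are built from their coordinates in this way.\<close>

lemma ell2_of_bounded_sums:
  fixes f :: "'i \<Rightarrow> complex"
  assumes "\<And>F. finite F \<Longrightarrow> (\<Sum>i\<in>F. (norm (f i))\<^sup>2) \<le> C\<^sup>2" and "C \<ge> 0"
  obtains x where "ell2_nth x = f" "norm x \<le> C"
proof -
  have s: "(\<lambda>i. (norm (f i))\<^sup>2) summable_on UNIV"
    by (rule nonneg_bdd_above_summable_on) (use assms(1) in \<open>auto intro!: bdd_aboveI2\<close>)
  then have x: "ell2_nth (Abs_ell2 f) = f"
    by (simp add: Abs_ell2_inverse)
  have "(norm (Abs_ell2 f))\<^sup>2 \<le> C\<^sup>2"
    unfolding norm_ell2_squared x using s assms(1) by (intro infsum_le_finite_sums) auto
  then show thesis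
    using that x \<open>C \<ge> 0\<close> by (simp add: power2_le_iff_abs_le)
qed

text \<open>The limit is taken coordinatewise. For fixed \<open>n\<close>, the finite partial sums
  of \<open>X m - X n\<close> stay bounded as \<open>m\<close> tends to infinity, which turns
  coordinatewise convergence into norm convergence.\<close>

instance ell2 :: (type) banach
proof
  fix X :: "nat \<Rightarrow> 'a ell2"
  assume X: "Cauchy X"
  define f where "f i = lim (\<lambda>n. ell2_nth (X n) i)" for i
  have f: "(\<lambda>n. ell2_nth (X n) i) \<longlonglongrightarrow> f i" for i
    unfolding f_def using bounded_linear.Cauchy[OF bounded_linear_ell2_nth X, of i]
    by (simp add: Cauchy_convergent_iff convergent_LIMSEQ_iff)
  have near: "\<exists>x. ell2_nth x = (\<lambda>i. f i - ell2_nth (X n) i) \<and> norm x \<le> e"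
    if "\<And>m. m \<ge> N \<Longrightarrow> norm (X m - X n) \<le> e" and "e \<ge> 0" for n N e
  proof -
    have "(\<Sum>i\<in>F. (norm (f i - ell2_nth (X n) i))\<^sup>2) \<le> e\<^sup>2" if "finite F" for F
    proof (rule tendsto_upperbound)
      show "(\<lambda>m. \<Sum>i\<in>F. (norm (ell2_nth (X m) i - ell2_nth (X n) i))\<^sup>2)
          \<longlonglongrightarrow> (\<Sum>i\<in>F. (norm (f i - ell2_nth (X n) i))\<^sup>2)"
        by (intro tendsto_intros f)
      have "(\<Sum>i\<in>F. (norm (ell2_nth (X m) i - ell2_nth (X n) i))\<^sup>2) \<le> e\<^sup>2" if "m \<ge> N" for m
      proof -
        have "(norm (X m - X n))\<^sup>2 \<le> e\<^sup>2"
          by (intro power_mono \<open>m \<ge> N \<Longrightarrow> norm (X m - X n) \<le> e\<close> that) auto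
        then show ?thesis
          using sum_norm_ell2_nth_le[OF \<open>finite F\<close>, of "X m - X n"] by simp
      qed
      then show "\<forall>\<^sub>F m in sequentially. (\<Sum>i\<in>F. (norm (ell2_nth (X m) i - ell2_nth (X n) i))\<^sup>2) \<le> e\<^sup>2"
        by (auto simp: eventually_sequentially)
    qed simp
    then show ?thesis
      using ell2_of_bounded_sums \<open>e \<ge> 0\<close> by metis
  qed
  have Cauchy: "\<exists>N. \<forall>m\<ge>N. \<forall>n\<ge>N. norm (X m - X n) \<le> e" if "e > 0" for e
    using CauchyD[OF X that] by (meson less_imp_le)
  obtain N where "\<forall>m\<ge>N. \<forall>n\<ge>N. norm (X m - X n) \<le> 1"
    using Cauchy[of 1] by auto
  then obtain d where d: "ell2_nth d = (\<lambda>i. f i - ell2_nth (X N) i)"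
    using near[of N N 1] by auto
  \<comment> \<open>The limit \<open>f\<close> is square-summable because \<open>X N\<close> and
    \<open>f - X N\<close> are.\<close>
  define x where "x = X N + d"
  have x: "ell2_nth x = f"
    by (simp add: x_def d)
  have "X \<longlonglongrightarrow> x"
  proof (rule metric_LIMSEQ_I)
    fix r :: real
    assume "r > 0"
    then obtain N where N: "\<forall>m\<ge>N. \<forall>n\<ge>N. norm (X m - X n) \<le> r/2"
      using Cauchy[of "r/2"] by auto
    have "dist (X n) x < r" if n: "n \<ge> N" for n
    proof -
      obtain d where d: "ell2_nth d = (\<lambda>i. f i - ell2_nth (X n) i)" "norm d \<le> r/2"
        using near[of N n "r/2"] N n \<open>r > 0\<close> by auto
      have "x - X n = d"
        by (rule ell2_eqI) (simp add: x d)
      then show ?thesis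
        using d \<open>r > 0\<close> by (simp add: dist_norm norm_minus_commute)
    qed
    then show "\<exists>no. \<forall>n\<ge>no. dist (X n) x < r"
      by blast
  qed
  then show "convergent X"
    by (rule convergentI)
qed

section \<open>Complex scalars, coordinates and adjoints\<close>

lemma norm_scaleC: "norm (c *\<^sub>C x) = norm c * norm x"
proof -
  have "(norm (c *\<^sub>C x))\<^sup>2 = (norm c * norm x)\<^sup>2"
    by (simp add: norm_ell2_squared power_mult_distrib norm_mult infsum_cmult_right')
  then show ?thesis
    by (simp add: power2_eq_iff_nonneg)
qed

lemma bounded_linear_scaleC: "bounded_linear ((*\<^sub>C) c)"
  by (rule bounded_linear_intro[where K = "norm c"])
    (auto intro!: ell2_eqI simp: algebra_simps norm_scaleC)

lemmas continuous_on_scaleC = bounded_linear.continuous_on[OF bounded_linear_scaleC]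

lemma scaleC_eq_scaleR: "c *\<^sub>C x = Re c *\<^sub>R x + Im c *\<^sub>R (\<i> *\<^sub>C x)"
  by (rule ell2_eqI) (simp add: complex_eq_iff)

lemma scaleC_one: "1 *\<^sub>C x = x"
  by (rule ell2_eqI) simp

lemma inner_ell2_scaleC_left: "inner (c *\<^sub>C x) y = inner x (cnj c *\<^sub>C y)"
  by (simp add: inner_ell2.rep_eq inner_complex_def algebra_simps)

text \<open>With \<open>c = 1\<close> and \<open>c = \<i>\<close> the real inner product reads off
  the real and the imaginary part of a coordinate.\<close>

lemma inner_scaleC_basis_ell2: "inner (c *\<^sub>C basis_ell2 i) x = inner c (ell2_nth x i)"
proof -
  have "(\<Sum>\<^sub>\<infinity>j. inner (ell2_nth (c *\<^sub>C basis_ell2 i) j) (ell2_nth x j))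
      = (\<Sum>\<^sub>\<infinity>j\<in>{i}. inner (ell2_nth (c *\<^sub>C basis_ell2 i) j) (ell2_nth x j))"
    by (rule infsum_cong_neutral) auto
  then show ?thesis
    by (simp add: inner_ell2.rep_eq)
qed

lemma basis_ell2_nonzero: "basis_ell2 i \<noteq> 0"
proof
  assume "basis_ell2 i = 0"
  then have "ell2_nth (basis_ell2 i) i = 0"
    by simp
  then show False
    by (simp del: zero_ell2.rep_eq)
qed

lemma ell2_truncation:
  assumes "e > 0"
  obtains F where "finite F" "norm (x - (\<Sum>i\<in>F. ell2_nth x i *\<^sub>C basis_ell2 i)) < e"
proof -
  let ?f = "\<lambda>i. (norm (ell2_nth x i))\<^sup>2"
  have "(?f has_sum infsum ?f UNIV) UNIV"
    using ell2_nth_summable by (rule has_sum_infsum)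
  then have "\<forall>\<^sub>F F in finite_subsets_at_top UNIV. dist (sum ?f F) (infsum ?f UNIV) < e\<^sup>2"
    unfolding has_sum_def using \<open>e > 0\<close> by (intro tendstoD) auto
  then obtain F where F: "finite F" "dist (sum ?f F) (infsum ?f UNIV) < e\<^sup>2"
    by (auto simp: eventually_finite_subsets_at_top)
  define t where "t = (\<Sum>i\<in>F. ell2_nth x i *\<^sub>C basis_ell2 i)"
  have t: "ell2_nth (x - t) i = (if i \<in> F then 0 else ell2_nth x i)" for i
    using F(1) by (simp add: t_def ell2_nth_sum if_distrib cong: if_cong)
  have "(norm (x - t))\<^sup>2 = infsum ?f (UNIV - F)"
    unfolding norm_ell2_squared t by (rule infsum_cong_neutral) auto
  also have "\<dots> = infsum ?f UNIV - sum ?f F"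
    using F(1) by (simp add: infsum_Diff ell2_nth_summable)
  also have "\<dots> < e\<^sup>2"
    using F(2) by (simp add: dist_real_def)
  finally have "norm (x - t) < e"
    using \<open>e > 0\<close> power2_less_imp_less less_imp_le by blast
  then show thesis
    by (rule that[OF F(1), folded t_def])
qed

text \<open>Finite truncations are dense. The maps are only real-linear, so agreement is asked for
  on all complex multiples of the basis vectors.\<close>

lemma bounded_linear_eq_on_basis:
  assumes f: "bounded_linear f" and g: "bounded_linear g"
    and eq: "\<And>c i. f (c *\<^sub>C basis_ell2 i) = g (c *\<^sub>C basis_ell2 i)"
  shows "f = g"
proof
  fix x
  let ?S = "{x. f x = g x}"
  have "closed ?S"
    by (intro closed_Collect_eq linear_continuous_on f g)
  moreover have "x \<in> closure ?S"
    unfolding closure_approachable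
  proof (intro allI impI)
    fix e :: real
    assume "e > 0"
    then obtain F where F: "norm (x - (\<Sum>i\<in>F. ell2_nth x i *\<^sub>C basis_ell2 i)) < e"
      using ell2_truncation by metis
    have "(\<Sum>i\<in>F. ell2_nth x i *\<^sub>C basis_ell2 i) \<in> ?S"
      by (simp add: linear_sum[OF bounded_linear.linear[OF f]]
          linear_sum[OF bounded_linear.linear[OF g]] eq)
    then show "\<exists>y\<in>?S. dist y x < e"
      using F by (metis dist_norm norm_minus_commute)
  qed
  ultimately show "f x = g x"
    by simp
qed

text \<open>Riesz representation of \<open>x \<mapsto> inner y (B x)\<close> by coordinates. The
  coordinates \<open>a i\<close> are forced by the values on the basis; testing with a truncation
  \<open>z\<close> of \<open>a\<close> gives
  \<open>norm z * norm z = inner (B z) y \<le> C * norm z\<close>, so the partial sums are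
  bounded.\<close>

lemma adjoint_vector_exists:
  fixes B :: "'i ell2 \<Rightarrow>\<^sub>L 'i ell2"
  obtains u where "norm u \<le> norm B * norm y" "\<And>x. inner u x = inner y (B x)"
proof -
  \<comment> \<open>\<open>B\<close> is only real-linear here, so the values at
    \<open>basis_ell2 i\<close> and at \<open>\<i> *\<^sub>C basis_ell2 i\<close> are independent
    data, one for each part of the coordinate.\<close>
  define a where "a i = Complex (inner (B (basis_ell2 i)) y) (inner (B (\<i> *\<^sub>C basis_ell2 i)) y)" for i
  have a: "inner c (a i) = inner (B (c *\<^sub>C basis_ell2 i)) y" for c i
    by (subst scaleC_eq_scaleR)
      (simp add: a_def inner_complex_def blinfun.add_right blinfun.scaleR_right inner_add_left)
  define C where "C = norm B * norm y"
  have "(\<Sum>i\<in>F. (norm (a i))\<^sup>2) \<le> C\<^sup>2" if "finite F" for F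
  proof -
    define z where "z = (\<Sum>i\<in>F. a i *\<^sub>C basis_ell2 i)"
    have z: "ell2_nth z i = (if i \<in> F then a i else 0)" for i
      using that by (simp add: z_def ell2_nth_sum if_distrib cong: if_cong)
    have "(\<Sum>i\<in>F. (norm (a i))\<^sup>2) = (\<Sum>i\<in>F. inner (a i) (ell2_nth z i))"
      by (intro sum.cong) (auto simp: z power2_norm_eq_inner)
    also have "\<dots> = inner z z"
      by (simp add: z_def inner_sum_left inner_scaleC_basis_ell2)
    finally have 1: "(\<Sum>i\<in>F. (norm (a i))\<^sup>2) = (norm z)\<^sup>2"
      by (simp add: power2_norm_eq_inner)
    have "(\<Sum>i\<in>F. (norm (a i))\<^sup>2) = inner (B z) y"
      by (simp add: z_def blinfun.sum_right inner_sum_left flip: a power2_norm_eq_inner)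
    also have "\<dots> \<le> norm (B z) * norm y"
      by (rule norm_cauchy_schwarz)
    also have "\<dots> \<le> (norm B * norm z) * norm y"
      by (intro mult_right_mono norm_blinfun) auto
    finally have "norm z * norm z \<le> C * norm z"
      unfolding 1 by (simp add: C_def power2_eq_square algebra_simps)
    then have "norm z \<le> C"
      by (cases "z = 0") (auto simp: C_def)
    then show ?thesis
      unfolding 1 by (intro power_mono) auto
  qed
  moreover have "C \<ge> 0"
    by (simp add: C_def)
  ultimately obtain u where u: "ell2_nth u = a" "norm u \<le> C"
    using ell2_of_bounded_sums by metis
  have "inner u = (\<lambda>x. inner y (B x))"
  proof (rule bounded_linear_eq_on_basis)
    show "bounded_linear (\<lambda>x. inner y (B x))"
      by (intro bounded_linear_intros)
    show "inner u (c *\<^sub>C basis_ell2 i) = inner y (B (c *\<^sub>C basis_ell2 i))" for c i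
      by (metis a inner_commute inner_scaleC_basis_ell2 u(1))
  qed (rule bounded_linear_inner_right)
  then show thesis
    using that u(2) by (metis C_def)
qed

lemma adjoint_exists:
  fixes B :: "'i ell2 \<Rightarrow>\<^sub>L 'i ell2"
  obtains B' where "\<And>x y. inner (blinfun_apply B' x) y = inner x (B y)"
proof -
  have "\<forall>y. \<exists>u. norm u \<le> norm B * norm y \<and> (\<forall>x. inner u x = inner y (B x))"
    using adjoint_vector_exists by blast
  then obtain f where f: "\<And>y. norm (f y) \<le> norm B * norm y" "\<And>x y. inner (f y) x = inner y (B x)"
    by metis
  have "bounded_linear f"
  proof (rule bounded_linear_intro)
    fix x y and r :: real
    have "inner (f (x + y)) z = inner (f x + f y) z" "inner (f (r *\<^sub>R x)) z = inner (r *\<^sub>R f x) z" for z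
      by (simp_all add: f(2) inner_add_left)
    then show "f (x + y) = f x + f y" "f (r *\<^sub>R x) = r *\<^sub>R f x"
      by (metis vector_eq_rdot)+
    show "norm (f x) \<le> norm x * norm B"
      using f(1)[of x] by (simp add: mult.commute)
  qed
  then show thesis
    using that[of "Blinfun f"] f(2) by (simp add: bounded_linear_Blinfun_apply)
qed

section \<open>Band operators\<close>

lemma BL_I: "(\<And>c x. blinfun_apply A (c *\<^sub>C x) = c *\<^sub>C blinfun_apply A x) \<Longrightarrow> A \<in> BL"
  by (simp add: BL_def)

lemma BL_D: "A \<in> BL \<Longrightarrow> blinfun_apply A (c *\<^sub>C x) = c *\<^sub>C blinfun_apply A x"
  by (simp add: BL_def)

lemma BL_id: "id_blinfun \<in> BL"
  by (simp add: BL_def)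

lemma BL_add: "A \<in> BL \<Longrightarrow> B \<in> BL \<Longrightarrow> A + B \<in> BL"
  by (auto intro!: BL_I ell2_eqI simp: BL_D blinfun.add_left algebra_simps)

lemma BL_scaleR: "A \<in> BL \<Longrightarrow> r *\<^sub>R A \<in> BL"
  by (auto intro!: BL_I ell2_eqI simp: BL_D blinfun.scaleR_left)

lemma BL_compose: "A \<in> BL \<Longrightarrow> B \<in> BL \<Longrightarrow> A o\<^sub>L B \<in> BL"
  by (simp add: BL_def)

lemma BL_inverse:
  assumes "A \<in> BL" "A o\<^sub>L S = id_blinfun" "S o\<^sub>L A = id_blinfun"
  shows "S \<in> BL"
proof (rule BL_I)
  fix c x
  have "blinfun_apply S (c *\<^sub>C blinfun_apply (A o\<^sub>L S) x) = blinfun_apply (S o\<^sub>L A) (c *\<^sub>C S x)"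
    by (simp add: BL_D[OF assms(1)])
  then show "S (c *\<^sub>C x) = c *\<^sub>C S x"
    by (simp add: assms)
qed

lemma closed_BL: "closed BL"
  unfolding BL_def
  by (intro closed_Collect_all closed_Collect_eq continuous_on_scaleC continuous_intros)

lemma mat_entry_basis: "A \<in> BL \<Longrightarrow> ell2_nth (blinfun_apply A (c *\<^sub>C basis_ell2 j)) i = c * mat_entry A i j"
  by (simp add: BL_D mat_entry_def)

text \<open>The scalar crosses the inner product as its conjugate, passes through \<open>B\<close>,
  and crosses back unconjugated.\<close>

lemma adjoint_in_BL:
  assumes "B \<in> BL" and adj: "\<And>x y. inner (blinfun_apply B' x) y = inner x (B y)"
  shows "B' \<in> BL"
proof (rule BL_I)
  fix c x
  have "inner (B' (c *\<^sub>C x)) y = inner (c *\<^sub>C B' x) y" for y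
    by (simp add: adj inner_ell2_scaleC_left BL_D[OF assms(1)])
  then show "B' (c *\<^sub>C x) = c *\<^sub>C B' x"
    by (metis vector_eq_rdot)
qed

text \<open>Bandwidth depends on the zero pattern alone, and an entry is zero as soon as its real
  inner product with every complex \<open>c\<close> is.\<close>

lemma mat_entry_adjoint_eq_0:
  assumes "B \<in> BL" and adj: "\<And>x y. inner (blinfun_apply B' x) y = inner x (B y)"
    and 0: "mat_entry B j i = 0"
  shows "mat_entry B' i j = 0"
proof -
  have "inner c (mat_entry B' i j) = 0" for c
  proof -
    have "inner c (mat_entry B' i j) = inner (basis_ell2 j) (B (c *\<^sub>C basis_ell2 i))"
      by (metis adj inner_commute inner_scaleC_basis_ell2 mat_entry_def)
    also have "\<dots> = inner (1 *\<^sub>C basis_ell2 j) (B (c *\<^sub>C basis_ell2 i))"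
      by (simp add: scaleC_one)
    also have "\<dots> = 0"
      by (simp only: inner_scaleC_basis_ell2 mat_entry_basis[OF assms(1)] 0) simp
    finally show ?thesis .
  qed
  then show ?thesis
    by (metis inner_eq_zero_iff)
qed

section \<open>Bandwidth under algebraic operations and limits\<close>

lemma BO_k_D: "A \<in> BO_k k \<Longrightarrow> \<bar>int_index i - int_index j\<bar> > int k \<Longrightarrow> mat_entry A i j = 0"
  by (simp add: BO_k_def)

lemma BO_k_subset_BL: "BO_k k \<subseteq> BL"
  by (auto simp: BO_k_def)

lemma BO_k_mono: "k \<le> l \<Longrightarrow> BO_k k \<subseteq> BO_k l"
  by (auto simp: BO_k_def)

lemma BO_k_id: "id_blinfun \<in> BO_k k"
  by (auto simp: BO_k_def BL_id mat_entry_def)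

lemma BO_k_add: "A \<in> BO_k k \<Longrightarrow> B \<in> BO_k k \<Longrightarrow> A + B \<in> BO_k k"
  by (auto simp: BO_k_def BL_add mat_entry_def blinfun.add_left)

lemma BO_k_scaleR: "A \<in> BO_k k \<Longrightarrow> r *\<^sub>R A \<in> BO_k k"
  by (auto simp: BO_k_def BL_scaleR mat_entry_def blinfun.scaleR_left)

lemma BO_k_diff: "A \<in> BO_k k \<Longrightarrow> B \<in> BO_k k \<Longrightarrow> A - B \<in> BO_k k"
  using BO_k_add[of A k "(- 1) *\<^sub>R B"] BO_k_scaleR[of B k "- 1"] by simp

lemma BO_k_adjoint:
  assumes "B \<in> BO_k k" "\<And>x y. inner (blinfun_apply B' x) y = inner x (B y)"
  shows "B' \<in> BO_k k"
  using assms adjoint_in_BL[of B B'] mat_entry_adjoint_eq_0[of B B']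
  by (auto simp: BO_k_def abs_minus_commute)

text \<open>Column \<open>j\<close> of \<open>B\<close> is a finite combination of basis vectors at
  distance at most \<open>l\<close> from \<open>j\<close>, so the product entry is a finite sum. If
  \<open>i\<close> is farther than \<open>k + l\<close> from \<open>j\<close>, every such
  \<open>p\<close> is farther than \<open>k\<close> from \<open>i\<close>.\<close>

lemma BO_k_compose:
  fixes A B :: "'i::ell2_index ell2 \<Rightarrow>\<^sub>L 'i ell2"
  assumes A: "A \<in> BO_k k" and B: "B \<in> BO_k l"
  shows "A o\<^sub>L B \<in> BO_k (k + l)"
proof -
  have BL: "A \<in> BL" "B \<in> BL"
    using A B BO_k_subset_BL by auto
  have "mat_entry (A o\<^sub>L B) i j = 0" if far: "\<bar>int_index i - int_index j\<bar> > int (k + l)" for i j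
  proof -
    define P where "P = {p :: 'i. \<bar>int_index p - int_index j\<bar> \<le> int l}"
    have "finite (int_index -` {int_index j - int l .. int_index j + int l} :: 'i set)"
      by (rule finite_vimageI) (simp_all add: inj_int_index)
    moreover have "P = int_index -` {int_index j - int l .. int_index j + int l}"
      by (auto simp: P_def)
    ultimately have [simp]: "finite P"
      by simp
    have "B (basis_ell2 j) = (\<Sum>p\<in>P. mat_entry B p j *\<^sub>C basis_ell2 p)"
    proof (rule ell2_eqI)
      fix i
      have "ell2_nth (\<Sum>p\<in>P. mat_entry B p j *\<^sub>C basis_ell2 p) i = (if i \<in> P then mat_entry B i j else 0)"
        by (simp add: ell2_nth_sum if_distrib cong: if_cong)
      also have "\<dots> = ell2_nth (B (basis_ell2 j)) i"
        using BO_k_D[OF B, of i j] by (simp add: P_def mat_entry_def)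
      finally show "ell2_nth (B (basis_ell2 j)) i = ell2_nth (\<Sum>p\<in>P. mat_entry B p j *\<^sub>C basis_ell2 p) i" ..
    qed
    then have "mat_entry (A o\<^sub>L B) i j = (\<Sum>p\<in>P. mat_entry B p j * mat_entry A i p)"
      by (simp add: mat_entry_def[of "A o\<^sub>L B"] blinfun.sum_right ell2_nth_sum mat_entry_basis[OF BL(1)])
    also have "\<dots> = 0"
      using far by (intro sum.neutral) (auto simp: P_def intro!: BO_k_D[OF A])
    finally show ?thesis .
  qed
  then show ?thesis
    using BL by (simp add: BO_k_def BL_compose)
qed

text \<open>Each matrix entry is continuous in the operator norm. Closedness settles the case of
  distance 0 in \<open>BO_k_approx\<close>.\<close>

lemma closed_BO_k: "closed (BO_k k)"
proof -
  have eq: "BO_k k = BL \<inter> {A. \<forall>i j. \<bar>int_index i - int_index j\<bar> > int k \<longrightarrow> mat_entry A i j = 0}"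
    by (auto simp: BO_k_def)
  show ?thesis
    unfolding eq mat_entry_def
    by (intro closed_Int closed_BL closed_Collect_all closed_Collect_imp closed_Collect_eq
        open_Collect_const continuous_on_ell2_nth continuous_intros)
qed

text \<open>For \<open>d > 0\<close> the factor 2 leaves room above the infimum, and for
  \<open>d = 0\<close> closedness gives \<open>A\<close> itself. This is the origin of every
  \<open>2 * \<delta> k\<close> in the final bound.\<close>

lemma BO_k_approx:
  assumes "infdist A (BO_k k) = d"
  obtains B where "B \<in> BO_k k" "norm (A - B) \<le> 2 * d"
proof (cases "d = 0")
  case True
  then have "A \<in> BO_k k"
    using assms in_closed_iff_infdist_zero[OF closed_BO_k, of k A] BO_k_id by blast
  then show thesis
    using that True by force
next
  case False
  then have "infdist A (BO_k k) < 2 * d"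
    using assms infdist_nonneg[of A "BO_k k"] by simp
  moreover have "BO_k k \<noteq> ({} :: ('a ell2 \<Rightarrow>\<^sub>L 'a ell2) set)"
    using BO_k_id by blast
  ultimately obtain B where "B \<in> BO_k k" "dist A B < 2 * d"
    by (auto simp: infdist_notempty cINF_less_iff bdd_below_image_dist)
  then show thesis
    using that by (simp add: dist_norm less_imp_le)
qed

lemma infdist_BO_k_tendsto_0:
  assumes "A \<in> closure BO"
  shows "(\<lambda>k. infdist A (BO_k k)) \<longlonglongrightarrow> 0"
proof (rule metric_LIMSEQ_I)
  fix e :: real
  assume "e > 0"
  then obtain B N where B: "B \<in> BO_k N" "dist B A < e"
    using assms by (auto simp: closure_approachable BO_def)
  have "infdist A (BO_k k) < e" if "k \<ge> N" for k
    using infdist_le[of B "BO_k k" A] BO_k_mono[OF that] B by (force simp: dist_commute)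
  then show "\<exists>N. \<forall>k\<ge>N. dist (infdist A (BO_k k)) 0 < e"
    by (auto simp: infdist_nonneg)
qed

text \<open>The iteration starts at bandwidth \<open>k\<close>, and each step composes with an
  operator of bandwidth \<open>2 * k\<close>.\<close>

lemma Richardson_in_BO_k:
  assumes B: "B \<in> BO_k k" "B' \<in> BO_k k"
  shows "Richardson \<tau> B B' n \<in> BO_k ((2 * n + 1) * k)"
proof (induction n)
  case 0
  then show ?case
    using assms by (simp add: BO_k_scaleR)
next
  case (Suc n)
  have "Richardson_op \<tau> B B' \<in> BO_k (k + k)"
    unfolding Richardson_op_def by (intro BO_k_diff BO_k_id BO_k_scaleR BO_k_compose assms)
  then have "Richardson_op \<tau> B B' o\<^sub>L Richardson \<tau> B B' n \<in> BO_k (k + k + (2 * n + 1) * k)"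
    using Suc by (rule BO_k_compose)
  moreover have "B' \<in> BO_k (k + k + (2 * n + 1) * k)"
    using B(2) BO_k_mono[of k "k + k + (2 * n + 1) * k"] by auto
  ultimately show ?case
    using BO_k_add BO_k_scaleR by (fastforce simp: algebra_simps)
qed

section \<open>Approximate inverses of a single banded operator\<close>

lemma norm_ge_left_inverse:
  fixes B T :: "'a::real_normed_vector \<Rightarrow>\<^sub>L 'a"
  assumes "T o\<^sub>L B = id_blinfun" "norm T \<le> 1 / c" "c > 0"
  shows "c * norm x \<le> norm (B x)"
proof -
  have "norm x = norm ((T o\<^sub>L B) x)"
    by (simp add: assms)
  also have "\<dots> \<le> norm T * norm (B x)"
    by (simp add: norm_blinfun)
  also have "\<dots> \<le> 1 / c * norm (B x)"
    using assms by (intro mult_right_mono) auto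
  finally show ?thesis
    using \<open>c > 0\<close> by (simp add: field_simps)
qed

text \<open>The lower bound on \<open>B\<close> is tested at one nonzero vector. This yields
  \<open>m \<le> M\<close> for \<open>A\<close> and makes the contraction factor of \<open>B\<close>
  nonnegative.\<close>

lemma norm_ge_inverse_bound:
  fixes B T :: "'i ell2 \<Rightarrow>\<^sub>L 'i ell2"
  assumes "T o\<^sub>L B = id_blinfun" "norm T \<le> 1 / c" "c > 0"
  shows "c \<le> norm B"
proof -
  have "c * norm (basis_ell2 i) \<le> norm B * norm (basis_ell2 i)" for i :: 'i
    using norm_ge_left_inverse[OF assms] norm_blinfun order_trans by blast
  then show ?thesis
    using basis_ell2_nonzero by (metis mult_le_cancel_right_pos zero_less_norm_iff)
qed

lemma banded_inverse_approx:
  assumes B: "B \<in> BO_k k" and BT: "B o\<^sub>L T = id_blinfun" "T o\<^sub>L B = id_blinfun"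
    and c: "norm T \<le> 1 / c" "c > 0"
  obtains C where "C \<in> BO_k ((2 * n + 1) * k)"
    "norm (T - C) \<le> (((norm B)\<^sup>2 - c\<^sup>2) / ((norm B)\<^sup>2 + c\<^sup>2)) ^ Suc n / c"
proof -
  obtain B' where adj: "\<And>x y. inner (blinfun_apply B' x) y = inner x (B y)"
    using adjoint_exists by metis
  define \<tau> where "\<tau> = 2 / ((norm B)\<^sup>2 + c\<^sup>2)"
  define q where "q = ((norm B)\<^sup>2 - c\<^sup>2) / ((norm B)\<^sup>2 + c\<^sup>2)"
  have below: "c * norm x \<le> norm (B x)" for x
    using BT(2) c by (rule norm_ge_left_inverse)
  have R: "norm (Richardson_op \<tau> B B') \<le> q"
    unfolding \<tau>_def q_def using adj below c(2) norm_ge_inverse_bound[OF BT(2) c] order_refl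
    by (rule norm_Richardson_op_le)
  then have "q \<ge> 0"
    using norm_ge_zero order_trans by blast
  have "norm (T - Richardson \<tau> B B' n) \<le> q ^ Suc n * norm T"
    using BT(1) R by (rule norm_inverse_diff_Richardson_le)
  also have "\<dots> \<le> q ^ Suc n * (1 / c)"
    using c \<open>q \<ge> 0\<close> by (intro mult_left_mono) auto
  finally have "norm (T - Richardson \<tau> B B' n) \<le> q ^ Suc n / c"
    by simp
  then show thesis
    unfolding q_def using that Richardson_in_BO_k[OF B BO_k_adjoint[OF B adj]] by blast
qed

section \<open>Inverses of band-dominated operators\<close>

text \<open>Makes \<open>1 / norm T\<close> a genuine quotient, so that \<open>m\<close> is
  positive.\<close>

lemma norm_left_inverse_pos:
  fixes B T :: "'i ell2 \<Rightarrow>\<^sub>L 'i ell2"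
  assumes "T o\<^sub>L B = id_blinfun"
  shows "norm T > 0"
proof -
  have "T \<noteq> 0"
    using arg_cong[OF assms, of "\<lambda>C. blinfun_apply C (basis_ell2 i)" for i] basis_ell2_nonzero
    by force
  then show ?thesis
    by simp
qed

text \<open>As \<open>c > 0\<close>, the contraction factor \<open>q\<close> is strictly below 1, so
  the banded Richardson approximants converge to \<open>T\<close>.\<close>

lemma inverse_of_banded_in_closure_BO:
  assumes B: "B \<in> BO_k k" and BT: "B o\<^sub>L T = id_blinfun" "T o\<^sub>L B = id_blinfun"
  shows "T \<in> closure BO"
  unfolding closure_approachable
proof (intro allI impI)
  fix e :: real
  assume "e > 0"
  define c where "c = 1 / norm T"
  have c: "c > 0" "norm T \<le> 1 / c"
    using norm_left_inverse_pos[OF BT(2)] by (simp_all add: c_def)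
  define q where "q = ((norm B)\<^sup>2 - c\<^sup>2) / ((norm B)\<^sup>2 + c\<^sup>2)"
  have cB: "c \<le> norm B"
    using BT(2) c by (intro norm_ge_inverse_bound)
  have "q \<ge> 0"
    using c cB by (simp add: q_def power_mono)
  moreover have "q < 1"
    using c by (simp add: q_def add_nonneg_pos)
  ultimately have "(\<lambda>n. q ^ n) \<longlonglongrightarrow> 0"
    by (intro LIMSEQ_realpow_zero)
  then have "\<forall>\<^sub>F n in sequentially. q ^ n < c * e"
    using c \<open>e > 0\<close> by (intro order_tendstoD) auto
  then obtain N where "\<forall>n\<ge>N. q ^ n < c * e"
    by (auto simp: eventually_sequentially)
  then have "q ^ Suc N < c * e"
    by (meson le_SucI order_refl)
  then have "q ^ Suc N / c < e"
    using c by (simp add: pos_divide_less_eq mult.commute)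
  moreover obtain C where "C \<in> BO_k ((2 * N + 1) * k)" "norm (T - C) \<le> q ^ Suc N / c"
    using banded_inverse_approx[OF B BT c(2,1)] unfolding q_def by blast
  ultimately show "\<exists>C\<in>BO. dist C T < e"
    by (auto simp: BO_def dist_norm norm_minus_commute intro!: bexI[of _ C])
qed

text \<open>The bounded inverse theorem puts \<open>inv A\<close> into the domain on which
  \<open>Blinfun\<close> is faithful.\<close>

lemma op_inverse_inverse:
  assumes "op_invertible A"
  shows "A o\<^sub>L op_inverse A = id_blinfun" "op_inverse A o\<^sub>L A = id_blinfun"
proof -
  have bij: "bij (blinfun_apply A)"
    using assms by (simp add: op_invertible_def)
  then have [simp]: "blinfun_apply (op_inverse A) = inv (blinfun_apply A)"
    unfolding op_inverse_def
    by (intro bounded_linear_Blinfun_apply bounded_linear_inv blinfun.bounded_linear_right)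
  show "A o\<^sub>L op_inverse A = id_blinfun" "op_inverse A o\<^sub>L A = id_blinfun"
    using bij by (auto intro!: blinfun_eqI simp: bij_is_surj bij_is_inj surj_f_inv_f)
qed

text \<open>With \<open>norm S = 1 / m\<close> the perturbation constant becomes
  \<open>(1 / m) / (1 - d / m) = 1 / (m - d)\<close>; the distance follows from the resolvent
  identity \<open>S - T = S (B - A) T\<close>.\<close>

lemma invertible_perturbation_dist:
  fixes A B S :: "'a::banach \<Rightarrow>\<^sub>L 'a"
  assumes AS: "A o\<^sub>L S = id_blinfun" and SA: "S o\<^sub>L A = id_blinfun"
    and S: "norm S = 1 / m" "m > 0" and d: "norm (A - B) \<le> d" "d < m"
  obtains T where "B o\<^sub>L T = id_blinfun" "T o\<^sub>L B = id_blinfun"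
    "norm T \<le> 1 / (m - d)" "norm (S - T) \<le> d / (m * (m - d))"
proof -
  have less: "norm S * norm (A - B) \<le> d / m" "d / m < 1"
    using S d by (simp_all add: divide_right_mono)
  then obtain T where BT: "B o\<^sub>L T = id_blinfun" "T o\<^sub>L B = id_blinfun"
    and T: "norm T \<le> norm S / (1 - norm S * norm (A - B))"
    using invertible_perturbation[OF AS SA, of B] by (metis le_less_trans)
  note T
  also have "norm S / (1 - norm S * norm (A - B)) \<le> norm S / (1 - d / m)"
    using less by (intro divide_left_mono mult_pos_pos) auto
  also have "\<dots> = 1 / (m - d)"
    using S by (simp add: field_simps)
  finally have T: "norm T \<le> 1 / (m - d)" .
  have "S - T = S o\<^sub>L (B - A) o\<^sub>L T"
  proof (rule blinfun_eqI)
    fix x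
    have "B (T x) = x" "S (A (T x)) = T x"
      using arg_cong[OF BT(1), of "\<lambda>C. blinfun_apply C x"]
        arg_cong[OF SA, of "\<lambda>C. blinfun_apply C (T x)"] by simp_all
    then show "(S - T) x = (S o\<^sub>L (B - A) o\<^sub>L T) x"
      by (simp add: blinfun.diff_left blinfun.diff_right)
  qed
  then have "norm (S - T) \<le> norm (S o\<^sub>L (B - A)) * norm T"
    by (simp add: norm_blinfun_compose)
  also have "\<dots> \<le> (norm S * norm (B - A)) * norm T"
    by (intro mult_right_mono norm_blinfun_compose) auto
  also have "\<dots> \<le> (1 / m * d) * (1 / (m - d))"
  proof -
    have "d \<ge> 0"
      using d(1) norm_ge_zero order_trans by blast
    then show ?thesis
      using S d T by (intro mult_mono) (auto simp: norm_minus_commute)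
  qed
  finally have "norm (S - T) \<le> d / (m * (m - d))"
    by simp
  then show thesis
    using that BT T by blast
qed

text \<open>Only an interval around \<open>norm A\<close> is known to contain \<open>norm B\<close>.
  Its upper end goes into the numerator and its lower end into the denominator, which gives the
  ratio in the theorem.\<close>

lemma contraction_factor_mono:
  fixes b c l u :: real
  assumes "0 \<le> l" "l \<le> b" "b \<le> u" "0 < c" "c \<le> b"
  shows "(b\<^sup>2 - c\<^sup>2) / (b\<^sup>2 + c\<^sup>2) \<le> (u\<^sup>2 - c\<^sup>2) / (l\<^sup>2 + c\<^sup>2)"
proof (rule frac_le)
  show "0 \<le> u\<^sup>2 - c\<^sup>2" "b\<^sup>2 - c\<^sup>2 \<le> u\<^sup>2 - c\<^sup>2" "l\<^sup>2 + c\<^sup>2 \<le> b\<^sup>2 + c\<^sup>2"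
    using assms by (simp_all add: power_mono)
  show "0 < l\<^sup>2 + c\<^sup>2"
    using \<open>0 < c\<close> by (simp add: add_nonneg_pos)
qed

text \<open>Two limits are taken: the inverse of \<open>A\<close> is a limit of inverses of banded
  operators, each of which is a limit of banded operators.\<close>

lemma op_inverse_BDO:
  assumes A: "A \<in> BDO" "op_invertible A"
  shows "op_inverse A \<in> BDO"
proof -
  define S where "S = op_inverse A"
  have AS: "A o\<^sub>L S = id_blinfun" "S o\<^sub>L A = id_blinfun"
    unfolding S_def using A(2) by (rule op_inverse_inverse)+
  define m where "m = 1 / norm S"
  have m: "norm S = 1 / m" "m > 0"
    using norm_left_inverse_pos[OF AS(2)] by (simp_all add: m_def)
  define \<delta> where "\<delta> k = infdist A (BO_k k)" for k
  have \<delta>: "\<delta> \<longlonglongrightarrow> 0"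
    unfolding \<delta>_def using A(1) by (intro infdist_BO_k_tendsto_0) (simp add: BDO_def)
  have "S \<in> closure (closure BO)"
    unfolding closure_approachable
  proof (intro allI impI)
    fix e :: real
    assume "e > 0"
    have "(\<lambda>k. 2 * \<delta> k / (m * (m - 2 * \<delta> k))) \<longlonglongrightarrow> 2 * 0 / (m * (m - 2 * 0))"
      using m by (intro tendsto_intros \<delta>) auto
    then have "\<forall>\<^sub>F k in sequentially. 2 * \<delta> k / (m * (m - 2 * \<delta> k)) < e"
      using \<open>e > 0\<close> by (intro order_tendstoD) auto
    moreover have "\<forall>\<^sub>F k in sequentially. \<delta> k < m / 2"
      using m by (intro order_tendstoD[OF \<delta>]) auto
    ultimately have "\<forall>\<^sub>F k in sequentially. 2 * \<delta> k / (m * (m - 2 * \<delta> k)) < e \<and> \<delta> k < m / 2"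
      by (rule eventually_conj)
    then obtain k where k: "2 * \<delta> k / (m * (m - 2 * \<delta> k)) < e" "\<delta> k < m / 2"
      by (auto dest: eventually_happens)
    obtain B where B: "B \<in> BO_k k" "norm (A - B) \<le> 2 * \<delta> k"
      using BO_k_approx \<delta>_def by metis
    obtain T where "B o\<^sub>L T = id_blinfun" "T o\<^sub>L B = id_blinfun"
      "norm (S - T) \<le> 2 * \<delta> k / (m * (m - 2 * \<delta> k))"
      using invertible_perturbation_dist[OF AS m B(2)] k by auto
    then show "\<exists>T\<in>closure BO. dist T S < e"
      using inverse_of_banded_in_closure_BO[OF B(1)] k
      by (metis dist_norm norm_minus_commute le_less_trans)
  qed
  then show ?thesis
    using BL_inverse[OF _ AS] A(1) by (simp add: BDO_def S_def)
qed

text \<open>The triangle inequality through the inverse \<open>T\<close> of a banded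
  \<open>B\<close> near \<open>A\<close>. This is sharper than the final bound, whose second summand
  carries the extra factor \<open>(M + 2 * \<delta>) / (m - 2 * \<delta>)\<close>.\<close>

lemma infdist_op_inverse_BO_k_le:
  fixes A :: "'i::ell2_index ell2 \<Rightarrow>\<^sub>L 'i ell2"
  assumes "op_invertible A" and \<delta>: "\<delta> = infdist A (BO_k k)"
    and m: "m = 1 / norm (op_inverse A)" and small: "\<delta> < m / 2" and n: "n \<ge> 1 \<or> k = 0"
  shows "infdist (op_inverse A) (BO_k (3 * n * k)) \<le> 2 * \<delta> / (m * (m - 2 * \<delta>)) +
    (((norm A + 2 * \<delta>)\<^sup>2 - (m - 2 * \<delta>)\<^sup>2) / ((norm A - 2 * \<delta>)\<^sup>2 + (m - 2 * \<delta>)\<^sup>2)) ^ Suc n / (m - 2 * \<delta>)"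
proof -
  define S where "S = op_inverse A"
  have AS: "A o\<^sub>L S = id_blinfun" "S o\<^sub>L A = id_blinfun"
    unfolding S_def using assms(1) by (rule op_inverse_inverse)+
  have m': "norm S = 1 / m" "m > 0"
    using norm_left_inverse_pos[OF AS(2)] by (simp_all add: m S_def)
  have mM: "m \<le> norm A"
    using norm_ge_inverse_bound[OF AS(2)] m' by simp
  define c where "c = m - 2 * \<delta>"
  have c: "c > 0"
    using small by (simp add: c_def)
  obtain B where B: "B \<in> BO_k k" "norm (A - B) \<le> 2 * \<delta>"
    using BO_k_approx \<delta> by metis
  obtain T where BT: "B o\<^sub>L T = id_blinfun" "T o\<^sub>L B = id_blinfun"
    and T: "norm T \<le> 1 / c" "norm (S - T) \<le> 2 * \<delta> / (m * c)"
    using invertible_perturbation_dist[OF AS m' B(2)] small by (auto simp: c_def)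
  have cB: "c \<le> norm B"
    using BT(2) T(1) c by (rule norm_ge_inverse_bound)
  define q where "q = ((norm B)\<^sup>2 - c\<^sup>2) / ((norm B)\<^sup>2 + c\<^sup>2)"
  define Q where "Q = ((norm A + 2 * \<delta>)\<^sup>2 - c\<^sup>2) / ((norm A - 2 * \<delta>)\<^sup>2 + c\<^sup>2)"
  have "norm A \<le> norm (A - B) + norm B" "norm B \<le> norm (A - B) + norm A"
    using norm_triangle_sub[of A B] norm_triangle_sub[of B A] by (simp_all add: norm_minus_commute)
  \<comment> \<open>The lower end \<open>norm A - 2 * \<delta>\<close> is nonnegative because
    \<open>2 * \<delta> < m \<le> norm A\<close>.\<close>
  then have "q \<le> Q"
    unfolding q_def Q_def using B(2) c cB mM small by (intro contraction_factor_mono) auto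
  moreover have "q \<ge> 0"
    using c cB by (simp add: q_def power_mono)
  ultimately have "q ^ Suc n \<le> Q ^ Suc n"
    by (rule power_mono)
  obtain C where C: "C \<in> BO_k ((2 * n + 1) * k)" "norm (T - C) \<le> q ^ Suc n / c"
    using banded_inverse_approx[OF B(1) BT T(1) c] unfolding q_def by blast
  \<comment> \<open>The Richardson bandwidth \<open>(2 * n + 1) * k\<close> fits into
    \<open>3 * n * k\<close> precisely under the hypothesis on \<open>n\<close> and
    \<open>k\<close>.\<close>
  have "2 * n + 1 \<le> 3 * n \<or> k = 0"
    using n by linarith
  then have "(2 * n + 1) * k \<le> 3 * n * k"
    using mult_le_mono1[of "2 * n + 1" "3 * n" k] by fastforce
  then have "infdist S (BO_k (3 * n * k)) \<le> norm (S - C)"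
    using infdist_le[of C "BO_k (3 * n * k)" S] C(1) BO_k_mono[of "(2 * n + 1) * k" "3 * n * k"]
    by (auto simp: dist_norm)
  also have "\<dots> \<le> norm (S - T) + norm (T - C)"
    using norm_triangle_ineq[of "S - T" "T - C"] by simp
  also have "\<dots> \<le> 2 * \<delta> / (m * c) + Q ^ Suc n / c"
    using T(2) C(2) divide_right_mono[OF \<open>q ^ Suc n \<le> Q ^ Suc n\<close>, of c] c by simp
  finally show ?thesis
    by (simp only: S_def Q_def c_def)
qed

theorem theorem2p3:
  fixes A :: "'i::ell2_index ell2 \<Rightarrow>\<^sub>L 'i ell2"
    and \<delta> \<alpha> \<kappa>p \<kappa>m :: "nat \<Rightarrow> real"
    and M m \<kappa> :: real
  assumes A: "A \<in> BDO" "op_invertible A"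
    and \<delta>: "\<And>k. \<delta> k = infdist A (BO_k k)"
    and M: "M = norm A"
    and m: "m = 1 / norm (op_inverse A)"
    and \<kappa>: "\<kappa> = M / m"
    and \<alpha>: "\<And>k. \<alpha> k = m / (m - 2 * \<delta> k)"
    and \<kappa>p: "\<And>k. \<kappa>p k = (M + 2 * \<delta> k) / (m / \<alpha> k)"
    and \<kappa>m: "\<And>k. \<kappa>m k = (M - 2 * \<delta> k) / (m / \<alpha> k)"
  shows "\<kappa> = norm A * norm (op_inverse A)
    \<and> (\<forall>k. \<kappa>p k = \<alpha> k * (\<kappa> + 2 * \<delta> k / m))
    \<and> (\<forall>k. \<kappa>m k = \<alpha> k * (\<kappa> - 2 * \<delta> k / m))
    \<and> \<delta> \<longlonglongrightarrow> 0
    \<and> \<alpha> \<longlonglongrightarrow> 1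
    \<and> (\<forall>\<^sub>F k in sequentially. \<delta> k < m / 2)
    \<and> (\<forall>n k. \<delta> k < m / 2 \<longrightarrow>
         (n \<ge> 1 \<or> k = 0 \<longrightarrow>
           infdist (op_inverse A) (BO_k (3 * n * k))
             \<le> \<alpha> k / m\<^sup>2 * (2 * \<delta> k + \<alpha> k * (M + 2 * \<delta> k) *
                 (((M + 2 * \<delta> k)\<^sup>2 - (m / \<alpha> k)\<^sup>2) / ((M - 2 * \<delta> k)\<^sup>2 + (m / \<alpha> k)\<^sup>2)) ^ (n + 1)))
         \<and> \<alpha> k / m\<^sup>2 * (2 * \<delta> k + \<alpha> k * (M + 2 * \<delta> k) *
                 (((M + 2 * \<delta> k)\<^sup>2 - (m / \<alpha> k)\<^sup>2) / ((M - 2 * \<delta> k)\<^sup>2 + (m / \<alpha> k)\<^sup>2)) ^ (n + 1))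
             = 2 * \<delta> k * \<alpha> k / m\<^sup>2 + (\<kappa>p k)\<^sup>2 / (M + 2 * \<delta> k) *
                 (((\<kappa>p k)\<^sup>2 - 1) / ((\<kappa>m k)\<^sup>2 + 1)) ^ (n + 1))
    \<and> op_inverse A \<in> BDO"
proof -
  define S where "S = op_inverse A"
  have SA: "S o\<^sub>L A = id_blinfun"
    unfolding S_def using A(2) by (rule op_inverse_inverse)
  have m0: "m > 0" and S: "norm S = 1 / m"
    using norm_left_inverse_pos[OF SA] by (simp_all add: m S_def)
  have mM: "m \<le> M"
    using norm_ge_inverse_bound[OF SA] S m0 M by simp
  have \<delta>0: "\<delta> k \<ge> 0" for k
    by (simp add: \<delta> infdist_nonneg)
  have lim\<delta>: "\<delta> \<longlonglongrightarrow> 0"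
    using infdist_BO_k_tendsto_0[of A] A(1) by (simp add: \<delta>[abs_def] BDO_def)
  have lim\<alpha>: "\<alpha> \<longlonglongrightarrow> 1"
  proof -
    have "(\<lambda>k. m / (m - 2 * \<delta> k)) \<longlonglongrightarrow> m / (m - 2 * 0)"
      using m0 by (intro tendsto_intros lim\<delta>) auto
    then show ?thesis
      using m0 by (simp add: \<alpha>[abs_def])
  qed
  have ev: "\<forall>\<^sub>F k in sequentially. \<delta> k < m / 2"
    using m0 by (intro order_tendstoD[OF lim\<delta>]) auto
  have \<kappa>': "\<kappa> = norm A * norm (op_inverse A)"
    using m0 by (simp add: \<kappa> M m)
  have \<kappa>p': "\<kappa>p k = \<alpha> k * (\<kappa> + 2 * \<delta> k / m)" and \<kappa>m': "\<kappa>m k = \<alpha> k * (\<kappa> - 2 * \<delta> k / m)" for k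
    using m0 by (simp_all add: \<kappa>p \<kappa>m \<kappa> add_divide_distrib diff_divide_distrib algebra_simps)
  define Q where "Q k = ((M + 2 * \<delta> k)\<^sup>2 - (m / \<alpha> k)\<^sup>2) / ((M - 2 * \<delta> k)\<^sup>2 + (m / \<alpha> k)\<^sup>2)" for k
  have bound: "infdist (op_inverse A) (BO_k (3 * n * k))
      \<le> \<alpha> k / m\<^sup>2 * (2 * \<delta> k + \<alpha> k * (M + 2 * \<delta> k) * Q k ^ (n + 1))"
    if small: "\<delta> k < m / 2" and n: "n \<ge> 1 \<or> k = 0" for n k
  proof -
    define c where "c = m - 2 * \<delta> k"
    have c: "c > 0" "c \<le> M + 2 * \<delta> k"
      using small mM \<delta>0[of k] by (simp_all add: c_def)
    have m\<alpha>: "m / \<alpha> k = c"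
      using m0 by (simp add: \<alpha> c_def)
    have "Q k \<ge> 0"
      using c by (simp add: Q_def m\<alpha> power_mono)
    \<comment> \<open>The factor \<open>(M + 2 * \<delta> k) / c\<close> is at least 1; inserting it
      weakens the sharper estimate to the claimed form.\<close>
    then have "Q k ^ Suc n / c * 1 \<le> Q k ^ Suc n / c * ((M + 2 * \<delta> k) / c)"
      using c by (intro mult_left_mono) auto
    moreover have "infdist (op_inverse A) (BO_k (3 * n * k)) \<le> 2 * \<delta> k / (m * c) + Q k ^ Suc n / c"
      using infdist_op_inverse_BO_k_le[OF A(2) \<delta> m small n] by (simp only: Q_def m\<alpha> c_def M)
    moreover have "\<alpha> k / m\<^sup>2 * (2 * \<delta> k + \<alpha> k * (M + 2 * \<delta> k) * Q k ^ (n + 1))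
        = 2 * \<delta> k / (m * c) + Q k ^ Suc n / c * ((M + 2 * \<delta> k) / c)"
    proof -
      have "m / c / m\<^sup>2 * (2 * d + m / c * W * X) = 2 * d / (m * c) + X / c * (W / c)" for d W X
        using m0 c(1) by (simp add: power2_eq_square field_simps)
      moreover have "\<alpha> k = m / c"
        by (simp add: \<alpha> c_def)
      ultimately show ?thesis
        by simp
    qed
    ultimately show ?thesis
      by linarith
  qed
  have eq: "\<alpha> k / m\<^sup>2 * (2 * \<delta> k + \<alpha> k * (M + 2 * \<delta> k) * Q k ^ (n + 1))
      = 2 * \<delta> k * \<alpha> k / m\<^sup>2 + (\<kappa>p k)\<^sup>2 / (M + 2 * \<delta> k) * (((\<kappa>p k)\<^sup>2 - 1) / ((\<kappa>m k)\<^sup>2 + 1)) ^ (n + 1)"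
    if small: "\<delta> k < m / 2" for n k
  proof -
    define c where "c = m / \<alpha> k"
    have c: "c > 0"
      using m0 small by (simp add: c_def \<alpha>)
    have pos: "M + 2 * \<delta> k > 0"
      using m0 mM \<delta>0[of k] by linarith
    have \<alpha>c: "\<alpha> k = m / c"
      using c by (auto simp: c_def)
    \<comment> \<open>Both condition numbers have denominator \<open>c\<close>, so expanding the
      fraction by the square of \<open>c\<close> clears them and leaves \<open>Q k\<close>.\<close>
    have "((\<kappa>p k)\<^sup>2 - 1) / ((\<kappa>m k)\<^sup>2 + 1) = (((\<kappa>p k)\<^sup>2 - 1) * c\<^sup>2) / (((\<kappa>m k)\<^sup>2 + 1) * c\<^sup>2)"
      using c by simp
    also have "\<dots> = Q k"
      using c unfolding Q_def \<kappa>p \<kappa>m c_def[symmetric]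
      by (simp add: power_divide left_diff_distrib distrib_right)
    finally have ratio: "((\<kappa>p k)\<^sup>2 - 1) / ((\<kappa>m k)\<^sup>2 + 1) = Q k" .
    have "m / c / m\<^sup>2 * (2 * d + m / c * W * X) = 2 * d * (m / c) / m\<^sup>2 + (W / c)\<^sup>2 / W * X"
      if "W > 0" for d W X
      using m0 c that by (simp add: power2_eq_square field_simps)
    moreover have "\<kappa>p k = (M + 2 * \<delta> k) / c"
      by (simp add: \<kappa>p c_def)
    ultimately show ?thesis
      using pos unfolding ratio by (simp only: \<alpha>c)
  qed
  show ?thesis
    unfolding Q_def[symmetric]
    by (intro conjI allI impI \<kappa>' \<kappa>p' \<kappa>m' lim\<delta> lim\<alpha> ev bound eq op_inverse_BDO A)
qed

end
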